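(* For every integer $k\geqslant2$, the ghost measure of the $k$-Zaremba sequence $z_k$ exists and is singular continuous, i.e. it has no atoms and is singular with respect to Lebesgue measure (its distribution function is continuous with derivative $0$ Lebesgue-almost everywhere).
   Context: For $k\geqslant2$ let ${\bf B}_i=\begin{pmatrix}i+1&1\\1&0\end{pmatrix}$ for $i=0,\dots,k-1$. The $k$-Zaremba sequence is $z_k(m)=(1\ 0)\,{\bf B}_{i_s}\cdots{\bf B}_{i_1}{\bf B}_{i_0}\,e_1$ for $m\geqslant1$ with base-$k$ expansion $i_s\cdots i_1i_0$, where $e_1=(1,0)^T$; it is a $k$-regular sequence with digit matrices ${\bf B}_0,\dots,{\bf B}_{k-1}$. For a sequence $f$, let $\Sigma(n)=\sum_{m=k^n}^{k^{n+1}-1}f(m)$ and $\mu_n=\frac1{\Sigma(n)}\sum_{m=0}^{k^{n+1}-k^n-1}f(k^n+m)\,\delta_{m/(k^n(k-1))}$ (probability measures on $\mathbb T=[0,1)$); the ghost measure of $f$ is the weak limit of $(\mu_n)$. *)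

theory Defs
  imports "HOL-Probability.Probability"
begin

definition zB :: "nat \<Rightarrow> real^2^2" where
  "zB i = vector [vector [real i + 1, 1], vector [1, 0]]"

text \<open>zmat k m = B_{i_s} ** ... ** B_{i_1} ** B_{i_0}, where i_s ... i_1 i_0 is the
  base-k expansion of m (m \<ge> 1); zmat k 0 is the identity.\<close>
function zmat :: "nat \<Rightarrow> nat \<Rightarrow> real^2^2" where
  "zmat k m = (if m = 0 \<or> k < 2 then mat 1 else zmat k (m div k) ** zB (m mod k))"
  by auto
termination
  by (relation "Wellfounded.measure (\<lambda>(k, m). m)") auto

definition zaremba :: "nat \<Rightarrow> nat \<Rightarrow> real" where
  "zaremba k m = (zmat k m *v vector [1, 0]) $ 1"

definition ghost_Sigma :: "nat \<Rightarrow> (nat \<Rightarrow> real) \<Rightarrow> nat \<Rightarrow> real" where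
  "ghost_Sigma k f n = (\<Sum>m = k^n..k^(n+1) - 1. f m)"

definition ghost_approx :: "nat \<Rightarrow> (nat \<Rightarrow> real) \<Rightarrow> nat \<Rightarrow> real measure" where
  "ghost_approx k f n = measure_of UNIV (sets borel)
     (\<lambda>A. ennreal ((\<Sum>m < k^(n+1) - k^n.
          f (k^n + m) * indicator A (real m / (real (k^n) * (real k - 1)))) / ghost_Sigma k f n))"

definition torus_weak_conv :: "(nat \<Rightarrow> real measure) \<Rightarrow> real measure \<Rightarrow> bool" where
  "torus_weak_conv M \<mu> \<longleftrightarrow>
     (\<forall>g :: real \<Rightarrow> real. continuous_on UNIV g \<and> (\<forall>x. g (x + 1) = g x) \<longrightarrow>
        (\<lambda>n. integral\<^sup>L (M n) g) \<longlonglongrightarrow> integral\<^sup>L \<mu> g)"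

definition torus_prob :: "real measure \<Rightarrow> bool" where
  "torus_prob \<mu> \<longleftrightarrow> prob_space \<mu> \<and> sets \<mu> = sets borel \<and> emeasure \<mu> (UNIV - {0..<1}) = 0"

definition is_ghost_measure :: "nat \<Rightarrow> (nat \<Rightarrow> real) \<Rightarrow> real measure \<Rightarrow> bool" where
  "is_ghost_measure k f \<mu> \<longleftrightarrow> torus_prob \<mu> \<and> torus_weak_conv (ghost_approx k f) \<mu>"

definition singular_continuous :: "real measure \<Rightarrow> bool" where
  "singular_continuous \<mu> \<longleftrightarrow>
     (\<forall>x. emeasure \<mu> {x} = 0) \<and>
     (\<exists>N \<in> sets borel. emeasure lborel N = 0 \<and> emeasure \<mu> (UNIV - N) = 0)"

end

theory Submission
  imports Defs
begin

text \<open>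
  Let \<open>\<rho>\<close> be the Perron root of the symmetric matrix \<open>B\<^sub>0 + \<dots> + B\<^bsub>k-1\<^esub>\<close>, with eigenvector
  \<open>v = (\<rho>, k)\<close>. Up to normalisation, the limit gives the \<open>k\<close>-adic cell of level \<open>n\<close> that belongs to
  \<open>M \<in> [k\<^sup>n, k\<^bsup>n+1\<^esup>)\<close> the mass \<open>a(M) / \<rho>\<^sup>n\<close>, where \<open>a(M)\<close> is the first row of the matrix product of
  \<open>M\<close> times \<open>v\<close>. Each child of a cell receives at most a fixed proportion \<open>1 - 1/\<rho>\<close> of its mass, so
  there are no atoms. The children \<open>0\<close> and \<open>1\<close> of a cell have masses whose ratio stays away from \<open>1\<close>, so
  the Cauchy--Schwarz inequality for the sum of the square roots of the children's masses is strict
  with a uniform factor \<open>\<theta> < 1\<close>. Hence the Hellinger affinity of the mass distribution and the uniform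
  distribution on the cells of level \<open>n\<close> is \<open>O(\<theta>\<^sup>n)\<close>. It bounds both the Lebesgue measure of the cells
  that are heavier than uniform and the mass of all the others, and Borel--Cantelli applied to both
  gives singularity.
\<close>

section \<open>Mass distributions on \<open>k\<close>-adic cells\<close>

lemma sum_blocks: "(\<Sum>m<n * b. f m) = (\<Sum>m<n. \<Sum>i<b. f (m * b + i))"
  for f :: "nat \<Rightarrow> 'a::comm_monoid_add"
proof -
  have "(\<Sum>m<n. sum f {m * b..<m * b + b}) = (\<Sum>m<n. \<Sum>i<b. f (m * b + i))"
    by (subst sum.atLeastLessThan_shift_0) (simp add: lessThan_atLeast0)
  then show ?thesis
    by (simp add: sum.nat_group)
qed

text \<open>\<open>p n j\<close> stands for the mass of the \<open>j\<close>-th of the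
  \<open>q * k^n\<close> cells of level \<open>n\<close>. A number with nonzero leading digit has
  \<open>k - 1\<close> choices for that digit, so \<open>q\<close> is kept separate from
  \<open>k\<close>. \<open>child\<close> excludes atoms and \<open>sqrt_children\<close> yields
  singularity.\<close>

locale kadic_masses =
  fixes k q :: nat and p :: "nat \<Rightarrow> nat \<Rightarrow> real" and c \<theta> :: real
  assumes k_ge_2: "k \<ge> 2" and q_pos: "q > 0"
    and nonneg: "p n j \<ge> 0"
    and outside: "q * k^n \<le> j \<Longrightarrow> p n j = 0"
    and total: "(\<Sum>j<q. p 0 j) = 1"
    and split: "p n j = (\<Sum>i<k. p (Suc n) (j * k + i))"
    and child: "i < k \<Longrightarrow> p (Suc n) (j * k + i) \<le> c * p n j"
    and c: "0 \<le> c" "c < 1"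
    and sqrt_children: "(\<Sum>i<k. sqrt (p (Suc n) (j * k + i))) \<le> \<theta> * sqrt (real k * p n j)"
    and \<theta>: "0 \<le> \<theta>" "\<theta> < 1"
begin

abbreviation N :: "nat \<Rightarrow> real" where
  "N n \<equiv> real (q * k^n)"

definition P :: "nat \<Rightarrow> nat \<Rightarrow> real" where
  "P n j = (\<Sum>i<j. p n i)"

lemma N_pos: "N n > 0"
  using k_ge_2 q_pos by simp

lemma N_add: "N (d + n) = N n * real (k^d)"
  by (simp add: power_add)

lemma P_0 [simp]: "P n 0 = 0"
  by (simp add: P_def)

lemma P_Suc: "P n (Suc j) = P n j + p n j"
  by (simp add: P_def)

lemma P_mono: "i \<le> j \<Longrightarrow> P n i \<le> P n j"
  unfolding P_def by (rule sum_mono2) (auto simp: nonneg)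

text \<open>By \<open>split\<close>, refining a cell does not change its mass, so the partial sums
  of all levels are values of one function on nested grids.\<close>

lemma P_refine: "P (d + n) (j * k^d) = P n j"
proof (induction d)
  case (Suc d)
  have "P (Suc d + n) (j * k^Suc d) = P (Suc (d + n)) ((j * k^d) * k)"
    by (simp add: mult_ac)
  also have "\<dots> = P (d + n) (j * k^d)"
    unfolding P_def by (simp add: sum_blocks split[symmetric])
  finally show ?case
    using Suc by simp
qed simp

lemma P_full:
  assumes "q * k^n \<le> j"
  shows "P n j = 1"
proof -
  have "P n j = P n (q * k^n)"
    unfolding P_def using assms by (intro sum.mono_neutral_right) (auto simp: outside)
  also have "\<dots> = P 0 q"
    using P_refine[of n 0 q] by simp
  finally show ?thesis
    by (simp add: P_def total)
qed

lemma P_le_1: "P n j \<le> 1"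
  using P_mono[of j "max j (q * k^n)" n] P_full[of n "max j (q * k^n)"] by simp

lemma p_small: "p n j \<le> c^n"
proof (induction n arbitrary: j)
  case 0
  have "p 0 j \<le> P 0 (Suc j)"
    using P_mono[of 0 j 0] by (simp add: P_Suc)
  then show ?case
    using P_le_1[of 0 "Suc j"] by simp
next
  case (Suc n)
  have "p (Suc n) j = p (Suc n) (j div k * k + j mod k)"
    by simp
  also have "\<dots> \<le> c * p n (j div k)"
    using k_ge_2 by (intro child) auto
  also have "\<dots> \<le> c * c^n"
    using Suc c by (intro mult_left_mono) auto
  finally show ?case
    by simp
qed

section \<open>Distribution function of the limit\<close>

lemma index_mult_le: "nat \<lfloor>x * N n\<rfloor> * k^d \<le> nat \<lfloor>x * N (d + n)\<rfloor>"
proof (cases "x \<ge> 0")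
  case True
  have "real (nat \<lfloor>x * N n\<rfloor> * k^d) \<le> x * N n * real (k^d)"
    unfolding of_nat_mult using True by (intro mult_right_mono of_nat_floor) auto
  also have "\<dots> = x * N (d + n)"
    by (simp only: N_add mult.assoc)
  finally show ?thesis
    by (simp add: le_nat_floor)
next
  case False
  then have "x * N n \<le> 0"
    by (intro mult_nonpos_nonneg) auto
  then have "nat \<lfloor>x * N n\<rfloor> = 0"
    by linarith
  then show ?thesis
    by simp
qed

lemma less_Suc_index: "x * N n < real (Suc (nat \<lfloor>x * N n\<rfloor>))"
  by linarith

text \<open>Together with \<open>index_mult_le\<close>: \<open>d\<close> levels further down, the
  index belonging to \<open>x\<close> stays between the first descendant of its cell and the first
  descendant of the next cell.\<close>

lemma index_le_mult: "nat \<lfloor>x * N (d + n)\<rfloor> \<le> Suc (nat \<lfloor>x * N n\<rfloor>) * k^d"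
proof -
  have "x * N (d + n) = x * N n * real (k^d)"
    by (simp only: N_add mult.assoc)
  also have "\<dots> \<le> real (Suc (nat \<lfloor>x * N n\<rfloor>)) * real (k^d)"
    using less_Suc_index[of x n] by (intro mult_right_mono) auto
  finally have "x * N (d + n) \<le> real (Suc (nat \<lfloor>x * N n\<rfloor>) * k^d)"
    unfolding of_nat_mult .
  then show ?thesis
    by linarith
qed

text \<open>The approximants add up the cells that lie entirely to the left of \<open>x\<close>;
  they increase with \<open>n\<close> and are bounded by 1. For negative \<open>x\<close>,
  \<open>nat\<close> truncates the index to 0, which gives the empty sum.\<close>

definition F :: "real \<Rightarrow> real" where
  "F x = lim (\<lambda>n. P n (nat \<lfloor>x * N n\<rfloor>))"

lemma approx_le: "P n (nat \<lfloor>x * N n\<rfloor>) \<le> P (d + n) (nat \<lfloor>x * N (d + n)\<rfloor>)"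
  using P_mono[OF index_mult_le[of x n d], of "d + n"] by (simp only: P_refine)

lemma le_approx: "P (d + n) (nat \<lfloor>x * N (d + n)\<rfloor>) \<le> P n (Suc (nat \<lfloor>x * N n\<rfloor>))"
  using P_mono[OF index_le_mult[of x d n], of "d + n"] by (simp only: P_refine)

lemma F_lim: "(\<lambda>n. P n (nat \<lfloor>x * N n\<rfloor>)) \<longlonglongrightarrow> F x"
proof -
  have "incseq (\<lambda>n. P n (nat \<lfloor>x * N n\<rfloor>))"
    by (rule incseq_SucI) (use approx_le[of _ x 1] in \<open>simp only: plus_1_eq_Suc\<close>)
  then obtain L where "(\<lambda>n. P n (nat \<lfloor>x * N n\<rfloor>)) \<longlonglongrightarrow> L"
    by (rule incseq_convergent[where B = 1]) (rule allI, rule P_le_1)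
  then show ?thesis
    unfolding F_def by (metis limI)
qed

lemma F_lower: "P n (nat \<lfloor>x * N n\<rfloor>) \<le> F x"
  by (rule tendsto_lowerbound[OF LIMSEQ_ignore_initial_segment[OF F_lim, of n]])
     (rule always_eventually allI approx_le trivial_limit_sequentially)+

lemma F_upper: "F x \<le> P n (Suc (nat \<lfloor>x * N n\<rfloor>))"
  by (rule tendsto_upperbound[OF LIMSEQ_ignore_initial_segment[OF F_lim, of n]])
     (rule always_eventually allI le_approx trivial_limit_sequentially)+

text \<open>At a grid point of level \<open>n\<close> the floor is exact on every finer level, so by
  \<open>P_refine\<close> the approximating sequence is constant from \<open>n\<close> on.\<close>

lemma F_grid: "F (real j / N n) = P n j"
proof (rule LIMSEQ_unique)
  show "(\<lambda>d. P (d + n) (nat \<lfloor>real j / N n * N (d + n)\<rfloor>)) \<longlonglongrightarrow> F (real j / N n)"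
    by (rule LIMSEQ_ignore_initial_segment[OF F_lim])
  have "nat \<lfloor>real j / N n * N (d + n)\<rfloor> = j * k^d" for d
  proof -
    have "real j / N n * N (d + n) = real (j * k^d)"
      using k_ge_2 q_pos by (simp add: power_add)
    then show ?thesis
      by (simp only: floor_of_nat nat_int)
  qed
  then show "(\<lambda>d. P (d + n) (nat \<lfloor>real j / N n * N (d + n)\<rfloor>)) \<longlonglongrightarrow> P n j"
    by (simp only: P_refine tendsto_const)
qed

lemma F_mono: "x \<le> y \<Longrightarrow> F x \<le> F y"
  by (rule LIMSEQ_le[OF F_lim F_lim])
     (auto intro!: exI[of _ 0] P_mono nat_mono floor_mono mult_right_mono)

lemma F_eq_0: "x \<le> 0 \<Longrightarrow> F x = 0"
  using F_mono[of x 0] F_grid[of 0 0] F_lower[of 0 x] P_mono[of 0 "nat \<lfloor>x * N 0\<rfloor>" 0] by simp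

lemma F_eq_1: "x \<ge> 1 \<Longrightarrow> F x = 1"
proof (rule antisym)
  show "F x \<le> 1"
    using F_upper[of x 0] P_le_1[of 0] by (rule order_trans)
  show "F x \<ge> 1" if "x \<ge> 1"
    using F_mono[OF that] F_grid[of q 0] q_pos P_full[of 0 q] by simp
qed

text \<open>An interval no longer than one cell touches at most two adjacent cells, each of mass at
  most \<open>c^n\<close>.\<close>

lemma F_increment:
  assumes "x \<le> y" "y \<le> x + 1 / N n"
  shows "F y \<le> F x + 2 * c^n"
proof -
  have "y * N n \<le> (x + 1 / N n) * N n"
    using assms by (intro mult_right_mono) auto
  also have "\<dots> = x * N n + 1"
    using k_ge_2 q_pos by (simp add: distrib_right)
  finally have "nat \<lfloor>y * N n\<rfloor> \<le> Suc (nat \<lfloor>x * N n\<rfloor>)"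
    by linarith
  then have "F y \<le> P n (Suc (Suc (nat \<lfloor>x * N n\<rfloor>)))"
    using F_upper[of y n] P_mono[of "Suc (nat \<lfloor>y * N n\<rfloor>)" "Suc (Suc (nat \<lfloor>x * N n\<rfloor>))" n] by auto
  also have "\<dots> \<le> F x + 2 * c^n"
    using F_lower[of n x] p_small[of n "nat \<lfloor>x * N n\<rfloor>"] p_small[of n "Suc (nat \<lfloor>x * N n\<rfloor>)"]
    unfolding P_Suc by linarith
  finally show ?thesis .
qed

lemma c_power_less:
  assumes "e > 0"
  obtains n where "c^n < e"
proof -
  have "(\<lambda>n. c^n) \<longlonglongrightarrow> 0"
    using c by (intro LIMSEQ_realpow_zero)
  from order_tendstoD(2)[OF this assms] show ?thesis
    using that by (auto simp: eventually_sequentially)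
qed

lemma isCont_F: "isCont F x"
proof (rule isCont_iff[THEN iffD2], rule LIM_I)
  fix e :: real
  assume "e > 0"
  then obtain n where n: "c^n < e / 2"
    using c_power_less[of "e / 2"] by auto
  have "\<bar>F (x + h) - F x\<bar> < e" if "\<bar>h\<bar> < 1 / N n" for h
    using that n F_increment[of x "x + h" n] F_increment[of "x + h" x n]
      F_mono[of x "x + h"] F_mono[of "x + h" x] by linarith
  then show "\<exists>s>0. \<forall>h. h \<noteq> 0 \<and> norm (h - 0) < s \<longrightarrow> norm (F (x + h) - F x) < e"
    using N_pos[of n] by (intro exI[of _ "1 / N n"]) auto
qed

section \<open>The limit measure and a criterion for convergence to it\<close>

definition limit_measure :: "real measure" where
  "limit_measure = interval_measure F"

lemma F_hyps:
  "x \<le> y \<Longrightarrow> F x \<le> F y" "continuous (at_right a) F" "(F \<longlongrightarrow> 0) at_bot" "(F \<longlongrightarrow> 1) at_top"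
proof -
  show "continuous (at_right a) F"
    using isCont_F by (rule continuous_at_imp_continuous_at_within)
  have "eventually (\<lambda>x. F x = 0) at_bot"
    using eventually_le_at_bot[of "0::real"] by eventually_elim (rule F_eq_0)
  moreover have "eventually (\<lambda>x. F x = 1) at_top"
    using eventually_ge_at_top[of "1::real"] by eventually_elim (rule F_eq_1)
  ultimately show "(F \<longlongrightarrow> 0) at_bot" "(F \<longlongrightarrow> 1) at_top"
    by (auto intro: tendsto_eventually)
qed (rule F_mono)

sublocale limit: real_distribution limit_measure
  unfolding limit_measure_def by (rule real_distribution_interval_measure) (rule F_hyps; assumption)+

lemma cdf_limit: "cdf limit_measure = F"
  unfolding limit_measure_def by (rule cdf_interval_measure) (rule F_hyps; assumption)+

lemma measure_Ioc: "x \<le> y \<Longrightarrow> measure limit_measure {x<..y} = F y - F x"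
  using limit.cdf_diff_eq[of x y] by (cases "x = y") (auto simp: cdf_limit)

lemma measure_singleton: "measure limit_measure {x} = 0"
  using isCont_F limit.isCont_cdf by (simp add: cdf_limit)

lemma emeasure_singleton: "emeasure limit_measure {x} = 0"
  by (simp add: limit.emeasure_eq_measure measure_singleton)

lemma torus_prob_limit: "torus_prob limit_measure"
  unfolding torus_prob_def
proof (intro conjI)
  \<comment> \<open>Increments of \<open>F\<close> measure left-open intervals. Passing from
    \<open>{0<..1}\<close> to \<open>{0..<1}\<close> costs only the point 1, which has no
    mass.\<close>
  have "measure limit_measure (UNIV - {0<..1}) = 0"
    using limit.prob_compl[of "{0<..1}"] measure_Ioc[of 0 1] by (simp add: F_eq_0 F_eq_1)
  then have "emeasure limit_measure (UNIV - {0<..1}) = 0"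
    by (simp add: limit.emeasure_eq_measure)
  moreover have "emeasure limit_measure (UNIV - {0..<1}) \<le>
      emeasure limit_measure ((UNIV - {0<..1}) \<union> {1})"
    by (rule emeasure_mono) auto
  moreover have "\<dots> \<le> emeasure limit_measure (UNIV - {0<..1}) + emeasure limit_measure {1}"
    by (rule emeasure_subadditive) auto
  ultimately show "emeasure limit_measure (UNIV - {0..<1}) = 0"
    by (simp add: emeasure_singleton)
qed (simp_all add: limit.prob_space_axioms)

text \<open>Convergence on the grids suffices: \<open>x\<close> is caught between the endpoints of
  its cell of level \<open>n\<close>, where the limit values differ by at most
  \<open>c^n\<close>.\<close>

lemma weak_convergence:
  assumes "\<And>m. real_distribution (\<nu> m)"
    and grid: "\<And>n j. (\<lambda>m. measure (\<nu> m) {..<real j / N n}) \<longlonglongrightarrow> P n j"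
  shows "weak_conv_m \<nu> limit_measure"
  unfolding weak_conv_m_def weak_conv_def cdf_limit
proof (intro allI impI)
  interpret \<nu>: real_distribution "\<nu> m" for m by fact
  fix x
  show "(\<lambda>m. cdf (\<nu> m) x) \<longlonglongrightarrow> F x"
  proof (rule order_tendstoI)
    fix a assume "a < F x"
    then obtain n where n: "c^n < F x - a"
      using c_power_less[of "F x - a"] by auto
    define j where "j = nat \<lfloor>x * N n\<rfloor>"
    have "a < P n j"
      using n F_upper[of x n] p_small[of n j] unfolding j_def P_Suc by linarith
    show "\<forall>\<^sub>F m in sequentially. a < cdf (\<nu> m) x"
    proof (cases "x \<ge> 0")
      case True
      then have "real j \<le> x * N n"
        unfolding j_def by (intro of_nat_floor) auto
      then have "real j / N n \<le> x"
        using N_pos[of n] by (simp add: pos_divide_le_eq)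
      then have "measure (\<nu> m) {..<real j / N n} \<le> cdf (\<nu> m) x" for m
        unfolding cdf_def by (intro \<nu>.finite_measure_mono) auto
      then show ?thesis
        using order_tendstoD(1)[OF grid \<open>a < P n j\<close>] by (auto elim!: eventually_mono intro: less_le_trans)
    next
      \<comment> \<open>Left of 0 the truncated index gives the grid point 0, which is not below
        \<open>x\<close>; but then \<open>P n j = 0\<close>, and nonnegativity of the distribution
        function is enough.\<close>
      case False
      then have "x * N n \<le> 0"
        by (intro mult_nonpos_nonneg) auto
      then have "j = 0"
        unfolding j_def by (simp add: floor_le_iff)
      then have "a < cdf (\<nu> m) x" for m
        using \<open>a < P n j\<close> \<nu>.cdf_nonneg[of m x] by simp
      then show ?thesis
        by simp
    qed
  next
    fix a assume "F x < a"
    then obtain n where n: "c^n < a - F x"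
      using c_power_less[of "a - F x"] by auto
    define j where "j = nat \<lfloor>x * N n\<rfloor>"
    have "P n (Suc j) < a"
      using n F_lower[of n x] p_small[of n j] unfolding j_def P_Suc by linarith
    have "x < real (Suc j) / N n"
      using less_Suc_index[of x n] N_pos[of n] unfolding j_def by (simp add: pos_less_divide_eq)
    then have "cdf (\<nu> m) x \<le> measure (\<nu> m) {..<real (Suc j) / N n}" for m
      unfolding cdf_def by (intro \<nu>.finite_measure_mono) auto
    then show "\<forall>\<^sub>F m in sequentially. cdf (\<nu> m) x < a"
      using order_tendstoD(2)[OF grid \<open>P n (Suc j) < a\<close>] by (auto elim!: eventually_mono intro: le_less_trans)
  qed
qed

section \<open>Singularity through the Hellinger affinity\<close>

lemma sum_sqrt_le: "(\<Sum>j<q * k^n. sqrt (p n j)) \<le> (\<theta> * sqrt k)^n * (\<Sum>j<q. sqrt (p 0 j))"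
proof (induction n)
  case (Suc n)
  have "(\<Sum>j<q * k^Suc n. sqrt (p (Suc n) j)) = (\<Sum>j<(q * k^n) * k. sqrt (p (Suc n) j))"
    by (simp add: mult_ac)
  also have "\<dots> = (\<Sum>j<q * k^n. \<Sum>i<k. sqrt (p (Suc n) (j * k + i)))"
    by (rule sum_blocks)
  also have "\<dots> \<le> (\<Sum>j<q * k^n. \<theta> * sqrt (real k * p n j))"
    by (intro sum_mono sqrt_children)
  also have "\<dots> = \<theta> * sqrt k * (\<Sum>j<q * k^n. sqrt (p n j))"
    by (simp add: sum_distrib_left real_sqrt_mult mult_ac)
  also have "\<dots> \<le> \<theta> * sqrt k * ((\<theta> * sqrt k)^n * (\<Sum>j<q. sqrt (p 0 j)))"
    using Suc \<theta> by (intro mult_left_mono) auto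
  finally show ?case
    by (simp add: mult_ac)
qed simp

text \<open>Left-open, so that the mass of a cell is an increment of \<open>F\<close>.\<close>

definition cell :: "nat \<Rightarrow> nat \<Rightarrow> real set" where
  "cell n j = {real j / N n<..real (Suc j) / N n}"

definition heavy :: "nat \<Rightarrow> nat set" where
  "heavy n = {j. j < q * k^n \<and> p n j \<ge> 1 / N n}"

definition heavy_set :: "nat \<Rightarrow> real set" where
  "heavy_set n = (\<Union>j\<in>heavy n. cell n j)"

lemma finite_heavy [simp]: "finite (heavy n)"
  unfolding heavy_def by simp

lemma cell_borel [measurable]: "cell n j \<in> sets borel"
  unfolding cell_def by simp

lemma heavy_set_borel [measurable]: "heavy_set n \<in> sets borel"
  unfolding heavy_set_def by (intro sets.finite_UN) auto

lemma disjoint_cells: "disjoint_family_on (cell n) A"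
proof -
  have *: "cell n i \<inter> cell n j = {}" if "i < j" for i j
  proof -
    have "real (Suc i) / N n \<le> real j / N n"
      using that by (intro divide_right_mono) auto
    then show ?thesis
      unfolding cell_def by (meson Ioc_disjoint)
  qed
  show ?thesis
    unfolding disjoint_family_on_def by (metis * Int_commute linorder_neqE_nat)
qed

lemma measure_cell: "measure limit_measure (cell n j) = p n j"
proof -
  have "real j / N n \<le> real (Suc j) / N n"
    by (intro divide_right_mono) auto
  then show ?thesis
    unfolding cell_def by (simp only: measure_Ioc F_grid P_Suc)
qed

text \<open>The left side is the Hellinger affinity of the masses and the uniform distribution on
  the cells of level \<open>n\<close>. Dividing by \<open>sqrt (N n)\<close> removes the factor
  \<open>sqrt k\<close> that \<open>sum_sqrt_le\<close> picks up at each level.\<close>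

lemma sum_sqrt_bound: "(\<Sum>j<q * k^n. sqrt (p n j)) / sqrt (N n) \<le> \<theta>^n * ((\<Sum>j<q. sqrt (p 0 j)) / sqrt q)"
proof -
  have "(\<Sum>j<q * k^n. sqrt (p n j)) / sqrt (N n) \<le>
      ((\<theta> * sqrt k)^n * (\<Sum>j<q. sqrt (p 0 j))) / sqrt (N n)"
    by (intro divide_right_mono sum_sqrt_le) auto
  also have "\<dots> = ((\<theta> * sqrt k)^n * (\<Sum>j<q. sqrt (p 0 j))) / (sqrt q * sqrt k ^ n)"
    by (simp add: real_sqrt_mult real_sqrt_power)
  also have "\<dots> = \<theta>^n * ((\<Sum>j<q. sqrt (p 0 j)) / sqrt q)"
    using k_ge_2 by (simp add: power_mult_distrib)
  finally show ?thesis .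
qed

text \<open>A heavy cell has length \<open>1 / N n \<le> sqrt (p n j) / sqrt (N n)\<close>, which is
  its contribution to the affinity.\<close>

lemma lborel_heavy_set: "emeasure lborel (heavy_set n) < \<infinity>"
  "measure lborel (heavy_set n) \<le> \<theta>^n * ((\<Sum>j<q. sqrt (p 0 j)) / sqrt q)"
proof -
  have cell: "emeasure lborel (cell n j) = ennreal (1 / N n)" for j
    using N_pos[of n] unfolding cell_def
    by (subst emeasure_lborel_Ioc) (auto simp: divide_right_mono diff_divide_distrib[symmetric])
  have "emeasure lborel (heavy_set n) \<le> (\<Sum>j\<in>heavy n. emeasure lborel (cell n j))"
    unfolding heavy_set_def by (rule emeasure_subadditive_finite) auto
  also have "\<dots> = ennreal (\<Sum>j\<in>heavy n. 1 / N n)"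
    unfolding cell by (rule sum_ennreal) simp
  also have "\<dots> \<le> ennreal ((\<Sum>j<q * k^n. sqrt (p n j)) / sqrt (N n))"
  proof (rule ennreal_leI)
    have "(\<Sum>j\<in>heavy n. 1 / N n) \<le> (\<Sum>j\<in>heavy n. sqrt (p n j) / sqrt (N n))"
    proof (rule sum_mono)
      fix j assume "j \<in> heavy n"
      then have "sqrt (1 / N n) \<le> sqrt (p n j)"
        unfolding heavy_def by (intro real_sqrt_le_mono) auto
      then have "sqrt (1 / N n) / sqrt (N n) \<le> sqrt (p n j) / sqrt (N n)"
        by (rule divide_right_mono) auto
      moreover have "sqrt (1 / N n) / sqrt (N n) = 1 / N n"
        by (simp only: real_sqrt_divide real_sqrt_one divide_divide_eq_left)
           (use N_pos[of n] in \<open>simp only: real_sqrt_mult_self abs_of_pos\<close>)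
      ultimately show "1 / N n \<le> sqrt (p n j) / sqrt (N n)"
        by simp
    qed
    also have "\<dots> \<le> (\<Sum>j<q * k^n. sqrt (p n j) / sqrt (N n))"
      by (rule sum_mono2) (auto simp: heavy_def nonneg)
    finally show "(\<Sum>j\<in>heavy n. 1 / N n) \<le> (\<Sum>j<q * k^n. sqrt (p n j)) / sqrt (N n)"
      by (simp only: sum_divide_distrib)
  qed
  also have "\<dots> \<le> ennreal (\<theta>^n * ((\<Sum>j<q. sqrt (p 0 j)) / sqrt q))"
    by (intro ennreal_leI sum_sqrt_bound)
  finally have *: "emeasure lborel (heavy_set n) \<le> ennreal (\<theta>^n * ((\<Sum>j<q. sqrt (p 0 j)) / sqrt q))" .
  then show "emeasure lborel (heavy_set n) < \<infinity>"
    by (rule le_less_trans) simp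
  show "measure lborel (heavy_set n) \<le> \<theta>^n * ((\<Sum>j<q. sqrt (p 0 j)) / sqrt q)"
    unfolding measure_def using * by (intro enn2real_leI)
      (use \<theta> in \<open>auto intro!: mult_nonneg_nonneg divide_nonneg_nonneg sum_nonneg simp: nonneg\<close>)
qed

text \<open>For a cell that is not heavy the comparison turns round: its mass satisfies
  \<open>p n j \<le> sqrt (p n j) / sqrt (N n)\<close>. The cells exhaust the mass, so nothing else
  lies outside the heavy set.\<close>

lemma limit_compl_heavy_set:
  "measure limit_measure (UNIV - heavy_set n) \<le> \<theta>^n * ((\<Sum>j<q. sqrt (p 0 j)) / sqrt q)"
proof -
  let ?I = "{..<q * k^n}"
  have "measure limit_measure (heavy_set n) = (\<Sum>j\<in>heavy n. p n j)"
    unfolding heavy_set_def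
    by (subst limit.finite_measure_finite_Union) (auto simp: disjoint_cells measure_cell)
  then have "measure limit_measure (UNIV - heavy_set n) = (\<Sum>j\<in>?I. p n j) - (\<Sum>j\<in>heavy n. p n j)"
    using limit.prob_compl[of "heavy_set n"] P_full[of n "q * k^n"] by (simp add: P_def)
  also have "\<dots> = (\<Sum>j\<in>?I - heavy n. p n j)"
    by (rule sum_diff[symmetric]) (auto simp: heavy_def)
  also have "\<dots> \<le> (\<Sum>j\<in>?I - heavy n. sqrt (p n j) / sqrt (N n))"
  proof (rule sum_mono)
    fix j assume "j \<in> ?I - heavy n"
    then have "sqrt (p n j) \<le> sqrt (1 / N n)"
      unfolding heavy_def by (intro real_sqrt_le_mono) auto
    then have "sqrt (p n j) * sqrt (p n j) \<le> sqrt (p n j) * sqrt (1 / N n)"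
      by (intro mult_left_mono) (auto simp: nonneg)
    then show "p n j \<le> sqrt (p n j) / sqrt (N n)"
      by (simp add: nonneg real_sqrt_divide)
  qed
  also have "\<dots> \<le> (\<Sum>j\<in>?I. sqrt (p n j) / sqrt (N n))"
    by (rule sum_mono2) (auto simp: nonneg)
  also have "\<dots> \<le> \<theta>^n * ((\<Sum>j<q. sqrt (p 0 j)) / sqrt q)"
    using sum_sqrt_bound by (simp only: sum_divide_distrib)
  finally show ?thesis .
qed

lemma singular_continuous_limit: "singular_continuous limit_measure"
  unfolding singular_continuous_def
proof (intro conjI allI bexI)
  \<comment> \<open>\<open>?U\<close> consists of the points in infinitely many heavy sets. A point
    outside it misses all but finitely many heavy sets and so lies in \<open>?V\<close>;
    Borel-Cantelli makes \<open>?U\<close> null for Lebesgue measure and \<open>?V\<close> null for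
    the limit.\<close>
  let ?U = "limsup heavy_set" and ?V = "limsup (\<lambda>n. UNIV - heavy_set n)"
  have bound: "summable (\<lambda>n. \<theta>^n * ((\<Sum>j<q. sqrt (p 0 j)) / sqrt q))"
    using \<theta> by (intro summable_mult2 summable_geometric) simp
  have "summable (\<lambda>n. measure lborel (heavy_set n))"
    by (rule summable_comparison_test'[OF bound]) (use lborel_heavy_set in simp)
  then have "?U \<in> null_sets lborel"
    using lborel_heavy_set by (intro borel_cantelli_limsup1) auto
  then show "emeasure lborel ?U = 0" "?U \<in> sets borel"
    by (auto simp: null_sets_def)
  have "summable (\<lambda>n. measure limit_measure (UNIV - heavy_set n))"
    by (rule summable_comparison_test'[OF bound]) (use limit_compl_heavy_set in simp)
  then have "?V \<in> null_sets limit_measure"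
    by (intro borel_cantelli_limsup1) (auto simp: limit.emeasure_eq_measure)
  moreover have "UNIV - ?U \<in> sets limit_measure"
    using \<open>?U \<in> sets borel\<close> by (intro limit.sets_M sets.Diff) simp_all
  moreover have "UNIV - ?U \<subseteq> ?V"
  proof
    fix x assume "x \<in> UNIV - ?U"
    then obtain n where n: "\<And>m. n \<le> m \<Longrightarrow> x \<notin> heavy_set m"
      by (auto simp: limsup_INF_SUP)
    have "\<exists>m\<in>{i..}. x \<notin> heavy_set m" for i
      by (intro bexI[of _ "max i n"]) (simp_all add: n)
    then show "x \<in> ?V"
      unfolding limsup_INF_SUP by simp
  qed
  ultimately have "UNIV - ?U \<in> null_sets limit_measure"
    by (rule null_sets_subset)
  then show "emeasure limit_measure (UNIV - ?U) = 0"
    by (rule null_setsD1)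
qed (rule emeasure_singleton)

end

section \<open>Rows of the matrix products\<close>

lemma zmat_div: "k \<ge> 2 \<Longrightarrow> n \<noteq> 0 \<Longrightarrow> zmat k n = zmat k (n div k) ** zB (n mod k)"
  by (subst zmat.simps) simp

lemma zaremba_entry: "zaremba k n = zmat k n $ 1 $ 1"
  by (simp add: zaremba_def matrix_vector_mult_def sum_2)

text \<open>With \<open>zaremba\<close> it forms the first row of \<open>zmat\<close>, and right
  multiplication by \<open>zB i\<close> acts on that row alone.\<close>

definition zbeta :: "nat \<Rightarrow> nat \<Rightarrow> real" where
  "zbeta k n = zmat k n $ 1 $ 2"

text \<open>\<open>M > 0\<close> matters: the number 0 has the identity as its matrix, not
  \<open>zB 0\<close>, so leading zeros do not count as digits.\<close>

lemma zaremba_step: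
  assumes "k \<ge> 2" "i < k" "M > 0"
  shows "zaremba k (M * k + i) = (real i + 1) * zaremba k M + zbeta k M"
    and "zbeta k (M * k + i) = zaremba k M"
proof -
  have "zmat k (M * k + i) = zmat k M ** zB i"
    using assms by (subst zmat_div) auto
  then show "zaremba k (M * k + i) = (real i + 1) * zaremba k M + zbeta k M"
    "zbeta k (M * k + i) = zaremba k M"
    by (simp_all add: zaremba_entry zbeta_def matrix_matrix_mult_def sum_2 zB_def)
qed

text \<open>A digit \<open>i\<close> turns the row \<open>(x, y)\<close> into
  \<open>((i + 1) * x + y, x)\<close>, which again has a positive first entry dominating a
  nonnegative second one.\<close>

lemma zaremba_bounds:
  assumes "k \<ge> 2"
  shows "0 \<le> zbeta k n \<and> zbeta k n \<le> zaremba k n \<and> 0 < zaremba k n"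
proof (induction n rule: less_induct)
  case (less n)
  show ?case
  proof (cases "n < k")
    case True
    have "zmat k 0 = mat 1"
      by (subst zmat.simps) simp
    then have "zmat k n = (if n = 0 then mat 1 else zB n)"
      using True zmat_div[OF assms, of n] by simp
    then show ?thesis
      by (auto simp: zaremba_entry zbeta_def mat_def zB_def)
  next
    case False
    define M i where "M = n div k" and "i = n mod k"
    have n: "n = M * k + i" and "i < k" "M > 0" "M < n"
      using False assms unfolding M_def i_def by (auto simp: div_greater_zero_iff)
    have "0 \<le> zbeta k M \<and> zbeta k M \<le> zaremba k M \<and> 0 < zaremba k M"
      by (rule less) fact
    moreover have "zaremba k M \<le> (real i + 1) * zaremba k M"
      using calculation by simp
    ultimately show ?thesis
      unfolding n zaremba_step[OF assms \<open>i < k\<close> \<open>M > 0\<close>] by linarith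
  qed
qed

lemma zaremba_nonneg: "k \<ge> 2 \<Longrightarrow> 0 \<le> zaremba k n"
  using zaremba_bounds[of k n] by simp

text \<open>The matrix \<open>zB 0 + \<dots> + zB (k - 1)\<close> has rows \<open>(tri k, k)\<close>
  and \<open>(k, 0)\<close>, hence the characteristic equation
  \<open>\<tau>^2 = tri k * \<tau> + k^2\<close>.\<close>

definition tri :: "nat \<Rightarrow> real" where
  "tri k = real k * (real k + 1) / 2"

lemma sum_tri: "(\<Sum>i<k. real i + 1) = tri k"
  by (induction k) (auto simp: tri_def field_simps)

text \<open>The vector \<open>(\<tau>, k)\<close> is an eigenvector of \<open>zB 0 + \<dots> + zB (k - 1)\<close> for an eigenvalue \<open>\<tau>\<close>.\<close>

definition eigenfun :: "real \<Rightarrow> nat \<Rightarrow> nat \<Rightarrow> real" where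
  "eigenfun \<tau> k n = \<tau> * zaremba k n + real k * zbeta k n"

text \<open>Summing over the appended digit inserts the sum of the \<open>zB i\<close> between the
  row of \<open>M\<close> and the vector \<open>(\<tau>, k)\<close>, which is an eigenvector by the
  assumed equation.\<close>

lemma eigenfun_children:
  assumes "k \<ge> 2" "M > 0" "\<tau>^2 = tri k * \<tau> + real k^2"
  shows "(\<Sum>i<k. eigenfun \<tau> k (M * k + i)) = \<tau> * eigenfun \<tau> k M"
proof -
  have "(\<Sum>i<k. eigenfun \<tau> k (M * k + i)) =
      (\<Sum>i<k. \<tau> * zaremba k M * (real i + 1) + (\<tau> * zbeta k M + real k * zaremba k M))"
    using assms by (intro sum.cong) (simp_all add: eigenfun_def zaremba_step, simp add: algebra_simps)
  also have "\<dots> = \<tau> * zaremba k M * tri k + real k * (\<tau> * zbeta k M + real k * zaremba k M)"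
    unfolding sum.distrib[of _ "\<lambda>_. \<tau> * zbeta k M + real k * zaremba k M"]
      sum_distrib_left[symmetric] sum_tri by simp
  also have "\<dots> = zaremba k M * (tri k * \<tau> + real k^2) + \<tau> * (real k * zbeta k M)"
    by (simp add: algebra_simps power2_eq_square)
  also have "\<dots> = \<tau> * eigenfun \<tau> k M"
    unfolding assms(3)[symmetric] by (simp add: eigenfun_def algebra_simps power2_eq_square)
  finally show ?thesis .
qed

lemma eigenfun_descendants:
  assumes "k \<ge> 2" "M > 0" "\<tau>^2 = tri k * \<tau> + real k^2"
  shows "(\<Sum>r<k^d. eigenfun \<tau> k (M * k^d + r)) = \<tau>^d * eigenfun \<tau> k M"
  using \<open>M > 0\<close>
proof (induction d arbitrary: M)
  case (Suc d)
  have "(\<Sum>r<k^Suc d. eigenfun \<tau> k (M * k^Suc d + r)) =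
      (\<Sum>r<k * k^d. eigenfun \<tau> k (M * k^Suc d + r))"
    by simp
  also have "\<dots> = (\<Sum>i<k. \<Sum>r<k^d. eigenfun \<tau> k ((M * k + i) * k^d + r))"
    unfolding sum_blocks by (simp add: algebra_simps)
  also have "\<dots> = (\<Sum>i<k. \<tau>^d * eigenfun \<tau> k (M * k + i))"
    using Suc.prems assms(1) by (intro sum.cong Suc.IH) auto
  also have "\<dots> = \<tau>^Suc d * eigenfun \<tau> k M"
    using Suc.prems assms by (simp add: sum_distrib_left[symmetric] eigenfun_children)
  finally show ?case .
qed simp

section \<open>Masses of the ghost measure\<close>

text \<open>The defect in Cauchy-Schwarz is \<open>k\<close> times the sum of squared deviations
  from the mean \<open>s\<close>. The terms 0 and 1 alone contribute at least
  \<open>(y 1 - y 0)^2 / 2\<close> to that sum, and \<open>k \<ge> 2\<close> absorbs the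
  half.\<close>

lemma strict_Cauchy_Schwarz:
  fixes y :: "nat \<Rightarrow> real"
  assumes "k \<ge> 2"
  shows "(\<Sum>i<k. y i)^2 \<le> real k * (\<Sum>i<k. (y i)^2) - (y 1 - y 0)^2"
proof -
  define s where "s = (\<Sum>i<k. y i) / real k"
  have s: "(\<Sum>i<k. y i) = real k * s"
    using assms unfolding s_def by simp
  have "(\<Sum>i<k. (y i - s)^2) = (\<Sum>i<k. (y i)^2) - 2 * s * (\<Sum>i<k. y i) + real k * s^2"
    by (simp add: power2_diff sum.distrib sum_subtractf sum_distrib_left mult_ac)
  also have "\<dots> = (\<Sum>i<k. (y i)^2) - real k * s^2"
    unfolding s by (simp add: power2_eq_square)
  finally have "(\<Sum>i<k. (y i)^2) - real k * s^2 = (\<Sum>i<k. (y i - s)^2)" ..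
  moreover have "(\<Sum>i<k. (y i - s)^2) \<ge> (\<Sum>i<2. (y i - s)^2)"
    using assms by (intro sum_mono2) auto
  moreover have "(\<Sum>i<2. (y i - s)^2) = (y 0 - s)^2 + (y 1 - s)^2"
    by (simp add: numeral_2_eq_2)
  moreover have "0 \<le> (y 0 + y 1 - 2 * s)^2"
    by simp
  ultimately have "(y 1 - y 0)^2 \<le> 2 * ((\<Sum>i<k. (y i)^2) - real k * s^2)"
    by (simp add: power2_eq_square algebra_simps)
  also have "\<dots> \<le> real k * ((\<Sum>i<k. (y i)^2) - real k * s^2)"
    using assms \<open>(\<Sum>i<k. (y i)^2) - real k * s^2 = _\<close>
    by (intro mult_right_mono) (auto simp: sum_nonneg)
  also have "\<dots> = real k * (\<Sum>i<k. (y i)^2) - (real k * s)^2"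
    by (simp add: power2_eq_square algebra_simps)
  finally show ?thesis
    unfolding s by linarith
qed

text \<open>Test functions on the torus are only known to be periodic and continuous, whereas
  convergence of integrals is derived for bounded ones.\<close>

lemma periodic_bounded:
  fixes g :: "real \<Rightarrow> real"
  assumes "continuous_on UNIV g" and per: "\<And>x. g (x + 1) = g x"
  shows "\<exists>B. \<forall>x. norm (g x) \<le> B"
proof -
  have int: "g (x + of_int m) = g x" for x and m :: int
  proof (induction m rule: int_induct[where k = 0])
    case (step1 i)
    then show ?case
      using per[of "x + of_int i"] by (simp add: add_ac)
  next
    case (step2 i)
    then show ?case
      using per[of "x + of_int (i - 1)"] by simp
  qed simp
  have "compact (g ` {0..1})"
    using assms(1) by (intro compact_continuous_image) (auto intro: continuous_on_subset)
  then obtain B where B: "\<And>x. x \<in> {0..1} \<Longrightarrow> norm (g x) \<le> B"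
    using compact_imp_bounded by (metis bounded_iff imageI)
  have "norm (g x) \<le> B" for x
    using B[of "frac x"] int[of "frac x" "\<lfloor>x\<rfloor>"] frac_lt_1[of x] by (simp add: frac_def)
  then show ?thesis
    by blast
qed

locale zaremba_base =
  fixes k :: nat
  assumes k_ge_2: "k \<ge> 2"
begin

section \<open>Characteristic roots and the growth of \<open>a\<close>\<close>

definition \<rho> :: real where
  "\<rho> = (tri k + sqrt (tri k ^ 2 + 4 * real k ^ 2)) / 2"

definition \<sigma> :: real where
  "\<sigma> = (tri k - sqrt (tri k ^ 2 + 4 * real k ^ 2)) / 2"

lemma char_roots: "\<rho>^2 = tri k * \<rho> + real k^2" "\<sigma>^2 = tri k * \<sigma> + real k^2"
proof -
  define s where "s = sqrt (tri k ^ 2 + 4 * real k ^ 2)"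
  have "s^2 = tri k ^ 2 + 4 * real k ^ 2"
    unfolding s_def by simp
  then show "\<rho>^2 = tri k * \<rho> + real k^2" "\<sigma>^2 = tri k * \<sigma> + real k^2"
    unfolding \<rho>_def \<sigma>_def s_def[symmetric]
    by (simp_all add: power_divide power2_sum power2_diff add_divide_distrib diff_divide_distrib
      power2_eq_square[of "tri k"] algebra_simps)
qed

lemma tri_ge: "tri k \<ge> 3"
proof -
  have "2 * (2 + 1) \<le> real k * (real k + 1)"
    using k_ge_2 by (intro mult_mono) auto
  then show ?thesis
    by (simp add: tri_def)
qed

lemma root_bounds: "\<rho> > 1" "\<bar>\<sigma>\<bar> < \<rho>" "\<sigma> < \<rho>"
proof -
  define s where "s = sqrt (tri k ^ 2 + 4 * real k ^ 2)"
  have s: "s > 0" "s \<ge> tri k"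
    using tri_ge unfolding s_def
    by (auto intro!: real_sqrt_gt_zero real_le_rsqrt add_pos_nonneg)
  show "\<rho> > 1" "\<bar>\<sigma>\<bar> < \<rho>" "\<sigma> < \<rho>"
    unfolding \<rho>_def \<sigma>_def s_def[symmetric] using tri_ge s by auto
qed

definition a :: "nat \<Rightarrow> real" where
  "a n = eigenfun \<rho> k n"

definition b :: "nat \<Rightarrow> real" where
  "b n = eigenfun \<sigma> k n"

text \<open>This is the eigenvector decomposition
  \<open>(\<rho> - \<sigma>, 0) = (\<rho>, k) - (\<sigma>, k)\<close> of the first unit
  vector.\<close>

lemma zaremba_eq: "zaremba k n = (a n - b n) / (\<rho> - \<sigma>)"
  using root_bounds by (simp add: a_def b_def eigenfun_def field_simps)

lemma a_pos: "a n > 0"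
  using zaremba_bounds[OF k_ge_2, of n] root_bounds k_ge_2
  by (auto simp: a_def eigenfun_def intro!: add_pos_nonneg mult_pos_pos)

lemma a_children: "M > 0 \<Longrightarrow> (\<Sum>i<k. a (M * k + i)) = \<rho> * a M"
  unfolding a_def using k_ge_2 char_roots(1) by (intro eigenfun_children)

text \<open>Only the upper left entry of \<open>zB i\<close> depends on \<open>i\<close>, so the
  children form an arithmetic progression.\<close>

lemma a_child_eq:
  assumes "M > 0" "i < k"
  shows "a (M * k + i) = a (M * k) + real i * \<rho> * zaremba k M"
  using zaremba_step[OF k_ge_2 assms(2,1)] zaremba_step[OF k_ge_2 _ assms(1), of 0] k_ge_2
  by (simp add: a_def eigenfun_def algebra_simps)

lemma a_le_first_child:
  assumes "M > 0"
  shows "a M \<le> a (M * k)"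
proof -
  have "real k * zbeta k M \<le> real k * zaremba k M" "0 \<le> \<rho> * zbeta k M"
    using zaremba_bounds[OF k_ge_2, of M] root_bounds by (auto intro!: mult_left_mono)
  moreover have "a (M * k) = \<rho> * zaremba k M + \<rho> * zbeta k M + real k * zaremba k M"
    using zaremba_step[OF k_ge_2 _ assms, of 0] k_ge_2
    by (simp add: a_def eigenfun_def distrib_left)
  ultimately show ?thesis
    unfolding a_def[of M] eigenfun_def by linarith
qed

text \<open>Each child has at least the value \<open>a M\<close>, by \<open>a_le_first_child\<close>
  and the progression. The children add up to \<open>\<rho> * a M\<close>, so one sibling
  \<open>i'\<close> already takes \<open>a M\<close> away from child \<open>i\<close>.\<close>

lemma a_child_le:
  assumes "M > 0" "i < k"
  shows "a (M * k + i) \<le> (\<rho> - 1) * a M"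
proof -
  define i' :: nat where "i' = (if i = 0 then 1 else 0)"
  have i': "i' < k" "i' \<noteq> i"
    using k_ge_2 by (auto simp: i'_def)
  have "a (M * k + i) + a (M * k + i') = (\<Sum>j\<in>{i, i'}. a (M * k + j))"
    using i' by simp
  also have "\<dots> \<le> (\<Sum>j<k. a (M * k + j))"
    using i' assms a_pos by (intro sum_mono2) (auto intro: less_imp_le)
  also have "\<dots> = \<rho> * a M"
    using assms by (intro a_children)
  finally have "a (M * k + i) + a (M * k + i') \<le> \<rho> * a M" .
  moreover have "0 \<le> real i' * \<rho> * zaremba k M"
    using zaremba_nonneg[OF k_ge_2, of M] root_bounds by simp
  then have "a M \<le> a (M * k + i')"
    using a_le_first_child[OF assms(1)] a_child_eq[OF assms(1) i'(1)] by linarith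
  ultimately show ?thesis
    by (simp add: algebra_simps)
qed

text \<open>The subtracted term is the defect \<open>E / (4 * (\<rho> + k)^2)\<close> found in
  \<open>sum_sqrt_a\<close>, relative to the Cauchy-Schwarz bound \<open>k * E\<close>.\<close>

definition \<theta> :: real where
  "\<theta> = sqrt (1 - 1 / (4 * real k * (\<rho> + real k)^2))"

lemma theta_bounds: "0 \<le> \<theta>" "\<theta> < 1"
proof -
  have "1 * 1 \<le> (4 * real k) * (\<rho> + real k)^2"
    using k_ge_2 root_bounds by (intro mult_mono) auto
  then have "0 < 1 / (4 * real k * (\<rho> + real k)^2)" "1 / (4 * real k * (\<rho> + real k)^2) \<le> 1"
    by (auto simp: divide_le_eq_1)
  then show "0 \<le> \<theta>" "\<theta> < 1"
    unfolding \<theta>_def by (auto simp: real_sqrt_lt_1_iff)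
qed

text \<open>Children 0 and 1 differ by \<open>\<rho> * zaremba k M\<close>, which is at least the
  proportion \<open>1 / (\<rho> + k)\<close> of the total \<open>E\<close> of all children. Their
  square roots then differ by at least \<open>sqrt E / (2 * (\<rho> + k))\<close>, and
  \<open>strict_Cauchy_Schwarz\<close> turns this into the factor \<open>\<theta>\<close>.\<close>

lemma sum_sqrt_a:
  assumes "M > 0"
  shows "(\<Sum>i<k. sqrt (a (M * k + i))) \<le> \<theta> * sqrt (real k * (\<rho> * a M))"
proof -
  let ?z = "zaremba k M" and ?e0 = "a (M * k)" and ?e1 = "a (M * k + 1)"
  define E where "E = \<rho> * a M"
  have z: "?z > 0" "zbeta k M \<le> ?z"
    using zaremba_bounds[OF k_ge_2, of M] by auto
  have E: "E > 0"
    using a_pos root_bounds unfolding E_def by auto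
  have e1: "?e1 = ?e0 + \<rho> * ?z"
    using a_child_eq[OF assms, of 1] k_ge_2 by simp
  have "?e0 \<le> ?e1"
    using e1 z root_bounds by simp
  have "?e1 \<le> (\<Sum>i<k. a (M * k + i))"
    using k_ge_2 a_pos by (intro member_le_sum) (auto intro: less_imp_le)
  then have "?e1 \<le> E"
    using a_children[OF assms] by (simp add: E_def)
  have "a M \<le> (\<rho> + real k) * ?z"
    using z mult_left_mono[of "zbeta k M" ?z "real k"] by (simp add: a_def eigenfun_def algebra_simps)
  then have "E \<le> \<rho> * ((\<rho> + real k) * ?z)"
    unfolding E_def using root_bounds by (intro mult_left_mono) auto
  also have "\<rho> * ((\<rho> + real k) * ?z) = (\<rho> + real k) * (?e1 - ?e0)"
    by (simp only: e1) simp
  \<comment> \<open>A difference of squares, to pass from the gap between the masses to the gap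
    between their square roots.\<close>
  also have "?e1 - ?e0 = (sqrt ?e1 - sqrt ?e0) * (sqrt ?e1 + sqrt ?e0)"
    using a_pos[of "M * k"] a_pos[of "M * k + 1"]
    by (simp add: algebra_simps less_imp_le power2_eq_square[symmetric])
  also have "(\<rho> + real k) * \<dots> \<le> (\<rho> + real k) * ((sqrt ?e1 - sqrt ?e0) * (2 * sqrt E))"
  proof (intro mult_left_mono)
    have "sqrt ?e1 \<le> sqrt E" "sqrt ?e0 \<le> sqrt E"
      using \<open>?e0 \<le> ?e1\<close> \<open>?e1 \<le> E\<close> by auto
    then show "sqrt ?e1 + sqrt ?e0 \<le> 2 * sqrt E"
      by linarith
  qed (use \<open>?e0 \<le> ?e1\<close> root_bounds in auto)
  finally have "E \<le> (\<rho> + real k) * ((sqrt ?e1 - sqrt ?e0) * (2 * sqrt E))" .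
  then have "sqrt E * sqrt E \<le> (2 * (\<rho> + real k) * (sqrt ?e1 - sqrt ?e0)) * sqrt E"
    using E by (simp add: algebra_simps)
  then have "sqrt E \<le> 2 * (\<rho> + real k) * (sqrt ?e1 - sqrt ?e0)"
    using E by (simp only: mult_le_cancel_right_pos real_sqrt_gt_0_iff)
  then have "(sqrt E)^2 \<le> (2 * (\<rho> + real k) * (sqrt ?e1 - sqrt ?e0))^2"
    using E by (intro power_mono) auto
  then have "E \<le> 4 * (\<rho> + real k)^2 * (sqrt ?e1 - sqrt ?e0)^2"
    using E unfolding power_mult_distrib by simp
  then have gap: "E / (4 * (\<rho> + real k)^2) \<le> (sqrt ?e1 - sqrt ?e0)^2"
    using root_bounds by (subst pos_divide_le_eq) (auto simp: mult_ac add_pos_nonneg intro!: zero_less_power)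
  have "(\<Sum>i<k. sqrt (a (M * k + i)))^2 \<le>
      real k * (\<Sum>i<k. (sqrt (a (M * k + i)))^2) - (sqrt ?e1 - sqrt ?e0)^2"
    using strict_Cauchy_Schwarz[OF k_ge_2, of "\<lambda>i. sqrt (a (M * k + i))"] by simp
  also have "(\<Sum>i<k. (sqrt (a (M * k + i)))^2) = E"
    using a_pos a_children[OF assms] by (simp add: less_imp_le E_def)
  also have "real k * E - (sqrt ?e1 - sqrt ?e0)^2 \<le> real k * E - E / (4 * (\<rho> + real k)^2)"
    using gap by simp
  also have "\<dots> = (1 - 1 / (4 * real k * (\<rho> + real k)^2)) * (real k * E)"
    using k_ge_2 by (simp add: left_diff_distrib)
  finally have "(\<Sum>i<k. sqrt (a (M * k + i))) \<le> sqrt ((1 - 1 / (4 * real k * (\<rho> + real k)^2)) * (real k * E))"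
    by (rule real_le_rsqrt)
  then show ?thesis
    by (simp only: real_sqrt_mult \<theta>_def E_def)
qed

section \<open>Normalised cell masses\<close>

definition Z :: real where
  "Z = (\<Sum>j<k - 1. a (1 + j))"

lemma Z_pos: "Z > 0"
  unfolding Z_def using k_ge_2 a_pos by (intro sum_pos) (auto simp: lessThan_empty_iff)

definition p :: "nat \<Rightarrow> nat \<Rightarrow> real" where
  "p n j = (if j < (k - 1) * k^n then a (k^n + j) / (\<rho>^n * Z) else 0)"

lemma child_index:
  assumes "i < k"
  shows "j * k + i < (k - 1) * k^Suc n \<longleftrightarrow> j < (k - 1) * k^n"
proof -
  have "j * k + i < ((k - 1) * k^n) * k \<longleftrightarrow> (j * k + i) div k < (k - 1) * k^n"
    using assms by (intro div_less_iff_less_mult[symmetric]) simp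
  then show ?thesis
    using assms by (simp add: mult_ac)
qed

text \<open>Since \<open>k^(n+1) + (j * k + i) = (k^n + j) * k + i\<close>, the subcells of a cell
  correspond to appending one digit to its number.\<close>

lemma p_child:
  assumes "i < k"
  shows "p (Suc n) (j * k + i) =
    (if j < (k - 1) * k^n then a ((k^n + j) * k + i) / (\<rho> * (\<rho>^n * Z)) else 0)"
  unfolding p_def child_index[OF assms] by (simp add: algebra_simps)

sublocale kadic_masses k "k - 1" p "1 - 1 / \<rho>" \<theta>
proof
  show "k \<ge> 2" "k - 1 > 0"
    using k_ge_2 by auto
  show "0 \<le> p n j" for n j
    using a_pos Z_pos root_bounds by (simp add: p_def less_imp_le)
  show "p n j = 0" if "(k - 1) * k^n \<le> j" for n j
    using that by (simp add: p_def)
  show "(\<Sum>j<k - 1. p 0 j) = 1"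
    using Z_pos by (simp add: p_def sum_divide_distrib[symmetric]) (simp add: Z_def)
  have pos: "k^n + j > 0" for n j
    using k_ge_2 by simp
  show "p n j = (\<Sum>i<k. p (Suc n) (j * k + i))" for n j
    using a_children[OF pos, of n j] root_bounds
    by (cases "j < (k - 1) * k^n") (simp_all add: p_child sum_divide_distrib[symmetric], simp_all add: p_def)
  show "p (Suc n) (j * k + i) \<le> (1 - 1 / \<rho>) * p n j" if "i < k" for n j i
  proof (cases "j < (k - 1) * k^n")
    case True
    have "a ((k^n + j) * k + i) / (\<rho> * (\<rho>^n * Z)) \<le> ((\<rho> - 1) * a (k^n + j)) / (\<rho> * (\<rho>^n * Z))"
      using a_child_le[OF pos that] root_bounds Z_pos by (intro divide_right_mono) auto
    also have "\<dots> = (1 - 1 / \<rho>) * (a (k^n + j) / (\<rho>^n * Z))"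
      using root_bounds by (simp add: field_simps)
    finally show ?thesis
      using True that by (simp add: p_child) (simp add: p_def)
  qed (use that in \<open>simp add: p_child, simp add: p_def\<close>)
  show "0 \<le> 1 - 1 / \<rho>" "1 - 1 / \<rho> < 1"
    using root_bounds by auto
  show "(\<Sum>i<k. sqrt (p (Suc n) (j * k + i))) \<le> \<theta> * sqrt (real k * p n j)" for n j
  proof (cases "j < (k - 1) * k^n")
    case True
    define D where "D = \<rho> * (\<rho>^n * Z)"
    have "(\<Sum>i<k. sqrt (p (Suc n) (j * k + i))) = (\<Sum>i<k. sqrt (a ((k^n + j) * k + i))) / sqrt D"
      using True by (simp add: p_child real_sqrt_divide sum_divide_distrib D_def)
    also have "\<dots> \<le> \<theta> * sqrt (real k * (\<rho> * a (k^n + j))) / sqrt D"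
      using root_bounds Z_pos unfolding D_def by (intro divide_right_mono sum_sqrt_a pos) auto
    also have "\<dots> = \<theta> * sqrt (real k * (\<rho> * a (k^n + j)) / D)"
      by (simp only: real_sqrt_divide times_divide_eq_right)
    also have "real k * (\<rho> * a (k^n + j)) / D = real k * p n j"
      using True root_bounds by (simp add: p_def D_def)
    finally show ?thesis .
  qed (simp add: p_child, simp add: p_def)
qed (rule theta_bounds)+

section \<open>Convergence of the approximating measures\<close>

lemma zaremba_descendants:
  assumes "M > 0"
  shows "(\<Sum>r<k^d. zaremba k (M * k^d + r)) = (\<rho>^d * a M - \<sigma>^d * b M) / (\<rho> - \<sigma>)"
  unfolding zaremba_eq sum_divide_distrib[symmetric] sum_subtractf a_def b_def
  using k_ge_2 assms char_roots by (simp add: eigenfun_descendants)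

text \<open>The part belonging to \<open>\<sigma>\<close> dies out after division by
  \<open>\<rho>^d\<close>, because \<open>\<bar>\<sigma>\<bar> < \<rho>\<close>.\<close>

lemma zaremba_descendants_limit:
  assumes "M > 0"
  shows "(\<lambda>d. (\<Sum>r<k^d. zaremba k (M * k^d + r)) / \<rho>^d) \<longlonglongrightarrow> a M / (\<rho> - \<sigma>)"
proof -
  have "\<bar>\<sigma> / \<rho>\<bar> < 1"
    using root_bounds by (simp add: abs_divide)
  then have "(\<lambda>d. (\<sigma> / \<rho>)^d) \<longlonglongrightarrow> 0"
    by (rule LIMSEQ_abs_realpow_zero2)
  then have "(\<lambda>d. (a M - (\<sigma> / \<rho>)^d * b M) / (\<rho> - \<sigma>)) \<longlonglongrightarrow> (a M - 0 * b M) / (\<rho> - \<sigma>)"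
    using root_bounds by (intro tendsto_intros) auto
  moreover have "(\<Sum>r<k^d. zaremba k (M * k^d + r)) / \<rho>^d = (a M - (\<sigma> / \<rho>)^d * b M) / (\<rho> - \<sigma>)" for d
    using root_bounds by (simp add: zaremba_descendants[OF assms] diff_divide_distrib power_divide)
  ultimately show ?thesis
    by simp
qed

definition T :: "nat \<Rightarrow> nat \<Rightarrow> real" where
  "T n j = (\<Sum>m<j. zaremba k (k^n + m))"

text \<open>The first \<open>j * k^d\<close> numbers of level \<open>d + l\<close> are grouped by
  their ancestors \<open>k^l + i\<close> of level \<open>l\<close>.\<close>

lemma T_limit: "(\<lambda>d. T (d + l) (j * k^d) / \<rho>^d) \<longlonglongrightarrow> (\<Sum>i<j. a (k^l + i)) / (\<rho> - \<sigma>)"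
proof -
  have "T (d + l) (j * k^d) / \<rho>^d =
      (\<Sum>i<j. (\<Sum>r<k^d. zaremba k ((k^l + i) * k^d + r)) / \<rho>^d)" for d
    unfolding T_def sum_blocks sum_divide_distrib by (simp add: power_add algebra_simps)
  moreover have "(\<lambda>d. \<Sum>i<j. (\<Sum>r<k^d. zaremba k ((k^l + i) * k^d + r)) / \<rho>^d)
      \<longlonglongrightarrow> (\<Sum>i<j. a (k^l + i) / (\<rho> - \<sigma>))"
    using k_ge_2 by (intro tendsto_sum zaremba_descendants_limit) simp
  ultimately show ?thesis
    by (simp add: sum_divide_distrib)
qed

lemma ghost_Sigma_eq: "ghost_Sigma k (zaremba k) n = T n ((k - 1) * k^n)"
proof -
  have "{k^n..k^(n + 1) - 1} = {k^n..<k^n + (k - 1) * k^n}"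
  proof -
    have "k^n + (k - 1) * k^n = k^(n + 1)"
      using k_ge_2 by (cases k) auto
    moreover have "k^(n + 1) > 0"
      using k_ge_2 by simp
    ultimately show ?thesis
      by (intro set_eqI) (simp only: atLeastAtMost_iff atLeastLessThan_iff, linarith)
  qed
  then show ?thesis
    unfolding ghost_Sigma_def T_def
    by (simp add: sum.atLeastLessThan_shift_0[of _ "k^n"] lessThan_atLeast0)
qed

lemma ghost_Sigma_pos: "ghost_Sigma k (zaremba k) n > 0"
  unfolding ghost_Sigma_eq T_def using zaremba_bounds[OF k_ge_2] k_ge_2
  by (intro sum_pos) (auto simp: lessThan_empty_iff)

lemma T_ratio_limit:
  assumes "j \<le> (k - 1) * k^l"
  shows "(\<lambda>d. T (d + l) (j * k^d) / ghost_Sigma k (zaremba k) (d + l)) \<longlonglongrightarrow> P l j"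
proof -
  have "(\<lambda>d. ghost_Sigma k (zaremba k) (d + l) / \<rho>^(d + l)) \<longlonglongrightarrow> Z / (\<rho> - \<sigma>)"
    using LIMSEQ_ignore_initial_segment[OF T_limit[of 0 "k - 1"], of l]
    by (simp add: ghost_Sigma_eq Z_def)
  \<comment> \<open>The numerator is scaled by \<open>\<rho>^d\<close> and the denominator by
    \<open>\<rho>^(d + l)\<close>; the surplus \<open>\<rho>^l\<close> is the one in the definition
    of \<open>p l\<close>.\<close>
  then have "(\<lambda>d. (T (d + l) (j * k^d) / \<rho>^d) / (ghost_Sigma k (zaremba k) (d + l) / \<rho>^(d + l)) / \<rho>^l)
      \<longlonglongrightarrow> ((\<Sum>i<j. a (k^l + i)) / (\<rho> - \<sigma>)) / (Z / (\<rho> - \<sigma>)) / \<rho>^l"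
    using Z_pos root_bounds
    by (intro tendsto_divide[OF tendsto_divide[OF T_limit] tendsto_const]) auto
  moreover have "(T (d + l) (j * k^d) / \<rho>^d) / (ghost_Sigma k (zaremba k) (d + l) / \<rho>^(d + l)) / \<rho>^l =
      T (d + l) (j * k^d) / ghost_Sigma k (zaremba k) (d + l)" for d
    using root_bounds by (simp add: power_add)
  moreover have "P l j = (\<Sum>i<j. a (k^l + i)) / (\<rho>^l * Z)"
    using assms unfolding P_def sum_divide_distrib by (intro sum.cong) (auto simp: p_def)
  ultimately show ?thesis
    using root_bounds by (simp add: mult.commute)
qed

text \<open>\<open>measure_of\<close> keeps a set function only if it is countably additive.
  Recognising the image of a finite point measure settles this.\<close>

lemma ghost_approx_eq:
  "ghost_approx k (zaremba k) n =
     distr (point_measure {..<k^(n+1) - k^n}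
        (\<lambda>m. ennreal (zaremba k (k^n + m) / ghost_Sigma k (zaremba k) n)))
       borel (\<lambda>m. real m / (real (k^n) * (real k - 1)))" (is "_ = ?D")
proof -
  let ?I = "{..<k^(n+1) - k^n}" and ?x = "\<lambda>m::nat. real m / (real (k^n) * (real k - 1))"
    and ?w = "\<lambda>m. zaremba k (k^n + m) / ghost_Sigma k (zaremba k) n"
  have w: "?w m \<ge> 0" for m
    using ghost_Sigma_pos[of n] zaremba_nonneg[OF k_ge_2] by (simp add: less_imp_le)
  have "ghost_approx k (zaremba k) n = measure_of UNIV (sets borel) (emeasure ?D)"
    unfolding ghost_approx_def
  proof (rule measure_of_eq)
    fix A :: "real set" assume "A \<in> sigma_sets UNIV (sets borel)"
    then have A: "A \<in> sets borel"
      using sets.sigma_sets_eq[of "borel :: real measure"] by simp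
    have "emeasure ?D A = (\<Sum>m\<in>?x -` A \<inter> ?I. ennreal (?w m))"
      using A by (subst emeasure_distr) (auto simp: emeasure_point_measure_finite space_point_measure)
    also have "\<dots> = (\<Sum>m\<in>?I. ennreal (?w m * indicator A (?x m)))"
      by (intro sum.mono_neutral_cong_left) (auto simp: indicator_def)
    also have "\<dots> = ennreal (\<Sum>m\<in>?I. ?w m * indicator A (?x m))"
      using w by (intro sum_ennreal mult_nonneg_nonneg) auto
    finally show "ennreal ((\<Sum>m\<in>?I. zaremba k (k^n + m) * indicator A (?x m)) /
        ghost_Sigma k (zaremba k) n) = emeasure ?D A"
      by (simp only: sum_divide_distrib times_divide_eq_left)
  qed simp
  also have "\<dots> = ?D"
    using measure_of_of_measure[of ?D] by simp
  finally show ?thesis .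
qed

lemma measure_ghost_approx:
  assumes "A \<in> sets borel"
  shows "measure (ghost_approx k (zaremba k) n) A =
    (\<Sum>m\<in>{m. m < (k - 1) * k^n \<and> real m / N n \<in> A}. zaremba k (k^n + m)) / ghost_Sigma k (zaremba k) n"
proof -
  have I: "k^(n+1) - k^n = (k - 1) * k^n" and N: "real (k^n) * (real k - 1) = N n"
    using k_ge_2 by (simp_all add: diff_mult_distrib of_nat_diff algebra_simps)
  have "measure (ghost_approx k (zaremba k) n) A =
      measure (point_measure {..<(k - 1) * k^n}
        (\<lambda>m. ennreal (zaremba k (k^n + m) / ghost_Sigma k (zaremba k) n)))
        ((\<lambda>m. real m / N n) -` A \<inter> {..<(k - 1) * k^n})"
    unfolding ghost_approx_eq I N using assms by (subst measure_distr) (auto simp: space_point_measure)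
  also have "\<dots> = (\<Sum>m\<in>(\<lambda>m. real m / N n) -` A \<inter> {..<(k - 1) * k^n}.
      zaremba k (k^n + m) / ghost_Sigma k (zaremba k) n)"
    using ghost_Sigma_pos[of n] zaremba_nonneg[OF k_ge_2]
    by (subst measure_point_measure_finite_if) (auto simp: less_imp_le)
  also have "(\<lambda>m. real m / N n) -` A \<inter> {..<(k - 1) * k^n} = {m. m < (k - 1) * k^n \<and> real m / N n \<in> A}"
    by auto
  finally show ?thesis
    by (simp only: sum_divide_distrib)
qed

lemma real_distribution_ghost_approx: "real_distribution (ghost_approx k (zaremba k) n)"
proof -
  have "{m. m < (k - 1) * k^n} = {..<(k - 1) * k^n}"
    by auto
  then have "measure (ghost_approx k (zaremba k) n) UNIV = 1"
    using ghost_Sigma_pos[of n] by (simp add: measure_ghost_approx) (simp add: ghost_Sigma_eq T_def)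
  moreover have sp: "space (ghost_approx k (zaremba k) n) = UNIV"
    "sets (ghost_approx k (zaremba k) n) = sets borel"
    by (simp_all add: ghost_approx_eq)
  ultimately have "emeasure (ghost_approx k (zaremba k) n) (space (ghost_approx k (zaremba k) n)) = 1"
    by (metis emeasure_eq_ennreal_measure ennreal_1 measure_zero_top zero_neq_one)
  then interpret prob_space "ghost_approx k (zaremba k) n"
    by (rule prob_spaceI)
  show ?thesis
    by unfold_locales (simp_all add: sp)
qed

text \<open>The atoms of level \<open>d + l\<close> lie on a refinement of the grid of level
  \<open>l\<close>, so the open ray contains exactly an initial block of them and the masses are
  ratios as in \<open>T_ratio_limit\<close>.\<close>

lemma ghost_approx_grid:
  "(\<lambda>n. measure (ghost_approx k (zaremba k) n) {..<real j / N l}) \<longlonglongrightarrow> P l j"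
proof (rule LIMSEQ_offset)
  \<comment> \<open>Beyond the last cell both sides stop changing, so \<open>j\<close> may be capped
    to meet the hypothesis of \<open>T_ratio_limit\<close>.\<close>
  define j' where "j' = min j ((k - 1) * k^l)"
  have "P l j = P l j'"
    unfolding j'_def min_def by (auto simp: P_full)
  moreover have "measure (ghost_approx k (zaremba k) (d + l)) {..<real j / N l} =
      T (d + l) (j' * k^d) / ghost_Sigma k (zaremba k) (d + l)" for d
  proof -
    have "real m / N (d + l) < real j / N l \<longleftrightarrow> m < j * k^d" for m
    proof -
      have "real m / N (d + l) < real j / N l \<longleftrightarrow> real m < real j / N l * N (d + l)"
        using N_pos[of "d + l"] by (rule pos_divide_less_eq)
      also have "real j / N l * N (d + l) = real (j * k^d)"
        using k_ge_2 unfolding N_add by simp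
      finally show ?thesis
        by (simp only: of_nat_less_iff)
    qed
    then have "{m. m < (k - 1) * k^(d + l) \<and> real m / N (d + l) \<in> {..<real j / N l}} =
        {m. m < (k - 1) * k^l * k^d \<and> m < j * k^d}"
      by (simp only: lessThan_iff) (simp add: power_add mult_ac)
    also have "\<dots> = {..<j' * k^d}"
      using k_ge_2 unfolding j'_def min_def by (auto intro: less_le_trans mult_right_mono)
    finally have "{m. m < (k - 1) * k^(d + l) \<and> real m / N (d + l) \<in> {..<real j / N l}} = {..<j' * k^d}" .
    then show ?thesis
      by (simp only: measure_ghost_approx[OF borel_open[OF open_lessThan]] T_def)
  qed
  ultimately show "(\<lambda>d. measure (ghost_approx k (zaremba k) (d + l)) {..<real j / N l}) \<longlonglongrightarrow> P l j"
    using T_ratio_limit[of j' l] by (simp add: j'_def)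
qed

lemma is_ghost_measure_limit: "is_ghost_measure k (zaremba k) limit_measure"
  unfolding is_ghost_measure_def torus_weak_conv_def
proof (intro conjI allI impI)
  show "torus_prob limit_measure"
    by (rule torus_prob_limit)
  fix g :: "real \<Rightarrow> real"
  assume g: "continuous_on UNIV g \<and> (\<forall>x. g (x + 1) = g x)"
  obtain B where B: "\<And>x. norm (g x) \<le> B"
    using periodic_bounded[of g] g by blast
  show "(\<lambda>n. integral\<^sup>L (ghost_approx k (zaremba k) n) g) \<longlonglongrightarrow> integral\<^sup>L limit_measure g"
  proof (rule weak_conv_imp_integral_bdd_continuous_conv)
    show "weak_conv_m (ghost_approx k (zaremba k)) limit_measure"
      by (intro weak_convergence real_distribution_ghost_approx ghost_approx_grid)
    show "isCont g x" for x
      using g by (simp add: continuous_on_eq_continuous_at)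
    show "norm (g x) \<le> B" for x
      by (rule B)
  qed (rule real_distribution_ghost_approx limit.real_distribution_axioms)+
qed

end

theorem theorem7:
  fixes k :: nat
  assumes "k \<ge> 2"
  shows "\<exists>\<mu>. is_ghost_measure k (zaremba k) \<mu> \<and> singular_continuous \<mu>"
proof -
  interpret zaremba_base k
    by unfold_locales fact
  show ?thesis
    using is_ghost_measure_limit singular_continuous_limit by blast
qed

end
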